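(* Let $f\in\mathbb{C}[x,y]$ be a nonzero binary form of degree $6$, and suppose that the highest multiplicity $m$ of a root of $f$ in $\mathbb{P}^1$ satisfies $m\ge 3$. Then the following hold. (1) $m=6$ if and only if $\operatorname{rank} f=1$. (2) $m=5$ if and only if $\operatorname{rank} f=6$. (3) If $m=4$, then $\operatorname{rank} f=5$. (4) If $m=3$, then $\operatorname{rank} f=4$.
   Context: The Waring rank $\operatorname{rank} f$ of a nonzero binary form $f\in\mathbb{C}[x,y]$ of degree $d$ is the minimal $r$ such that $f=\ell_1^d+\cdots+\ell_r^d$ with $\ell_j\in\mathbb{C}[x,y]$ linear forms. The multiplicity of a root of $f$ in $\mathbb{P}^1$ is the exact exponent of the corresponding linear factor in $f$. *)

theory Defs
  imports Complex_Main "HOL-Computational_Algebra.Computational_Algebra"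
    "HOL-Computational_Algebra.Field_as_Ring"
begin

text \<open>
  The ring $\mathbb{C}[x,y]$ is rendered as $\mathbb{C}[x][y]$, i.e. the type
  \<^typ>\<open>complex poly poly\<close>: the outer indeterminate is $y$, the inner one is $x$, and
  \<open>coeff (coeff f j) i\<close> is the coefficient of $x^i y^j$.
\<close>

definition X :: "complex poly poly" where
  "X = [:[:0, 1:]:]"

definition Y :: "complex poly poly" where
  "Y = [:0, 1:]"

definition const :: "complex \<Rightarrow> complex poly poly" where
  "const c = [:[:c:]:]"

definition eval2 :: "complex poly poly \<Rightarrow> complex \<Rightarrow> complex \<Rightarrow> complex" where
  "eval2 f a b = poly (poly f [:b:]) a"

text \<open>As usual, the zero polynomial counts as a form of every degree.\<close>

definition binary_form :: "nat \<Rightarrow> complex poly poly \<Rightarrow> bool" where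
  "binary_form d f \<longleftrightarrow> (\<forall>i j. coeff (coeff f j) i \<noteq> 0 \<longrightarrow> i + j = d)"

text \<open>
  The degree \<open>d\<close> of the form is an explicit argument; it is determined by \<open>f\<close> when
  \<open>f\<close> is nonzero. The set of admissible \<open>r\<close> is nonempty for every form of degree
  \<open>d \<ge> 1\<close>, since the \<open>d\<close>-th powers of linear forms span the forms of degree \<open>d\<close>.
\<close>

definition waring_rank :: "nat \<Rightarrow> complex poly poly \<Rightarrow> nat" where
  "waring_rank d f =
     (LEAST r. \<exists>l. (\<forall>j<r. binary_form 1 (l j)) \<and> f = (\<Sum>j<r. l j ^ d))"

text \<open>
  A point of $\mathbb{P}^1$ is given by homogeneous coordinates \<open>(a, b) \<noteq> (0, 0)\<close>; the linear
  factor vanishing there is $bx - ay$, whose exact exponent in \<open>f\<close> does not depend on the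
  representative (lemma \<open>root_multiplicity_scale\<close>).
\<close>

definition root_multiplicity :: "complex poly poly \<Rightarrow> complex \<Rightarrow> complex \<Rightarrow> nat" where
  "root_multiplicity f a b = multiplicity (const b * X - const a * Y) f"

text \<open>
  The maximum is over a finite set of values: for a nonzero form of degree \<open>d\<close> all of
  them are at most \<open>d\<close>. For \<open>d \<ge> 1\<close> the set is nonempty.
\<close>

definition highest_root_multiplicity :: "complex poly poly \<Rightarrow> nat" where
  "highest_root_multiplicity f =
     Max {root_multiplicity f a b | a b. (a, b) \<noteq> (0, 0) \<and> eval2 f a b = 0}"

lemma binary_form_1_iff:
  "binary_form 1 l \<longleftrightarrow> (\<exists>a b. l = const a * X + const b * Y)"
proof
  assume l: "binary_form 1 l"
  have "l = const (coeff (coeff l 0) 1) * X + const (coeff (coeff l 1) 0) * Y"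
  proof (intro poly_eqI)
    fix i j
    have "coeff (coeff l j) i = 0" if "i + j \<noteq> 1"
      using l that by (auto simp: binary_form_def)
    then show "coeff (coeff l j) i =
        coeff (coeff (const (coeff (coeff l 0) 1) * X + const (coeff (coeff l 1) 0) * Y) j) i"
      by (cases i; cases j)
         (auto simp: const_def X_def Y_def coeff_pCons split: nat.splits)
  qed
  then show "\<exists>a b. l = const a * X + const b * Y" by blast
qed (auto simp: binary_form_def const_def X_def Y_def coeff_pCons split: nat.splits)

lemma root_multiplicity_scale:
  assumes "c \<noteq> 0"
  shows "root_multiplicity f (c * a) (c * b) = root_multiplicity f a b"
proof -
  have "const (c * b) * X - const (c * a) * Y = const c * (const b * X - const a * Y)"
    by (simp add: const_def X_def Y_def algebra_simps)
  moreover have "is_unit (const c)"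
    using assms by (simp add: const_def is_unit_const_poly_iff dvd_field_iff)
  ultimately show ?thesis
    by (simp add: root_multiplicity_def multiplicity_times_unit_left)
qed

end

theory Submission
  imports Defs
begin

text \<open>
  Choose coordinates $L, M$ with $L$ vanishing at a root of multiplicity $m$ and write
  $f = \sum_i \binom{d}{i} s_i L^i M^{d-i}$, so that $s_0 = \dots = s_{m-1} = 0 \neq s_m$.
  Then $f = \sum_j (u_j L + v_j M)^d$ iff $s_i = \sum_j u_j^i v_j^{d-i}$ for all $i \le d$.
  For $m < d \le 2m$ the rank is $m + 1$. With at most $m < d$ summands, a monic polynomial
  $G$ of degree $m$ vanishing at all ratios $u_j/v_j$ gives
  $0 = \sum_j v_j^d G(u_j/v_j) = \sum_i G_i s_i = s_m$, a contradiction. Conversely, the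
  polynomials $g$ of degree $m + 1$ with $\sum_i g_i s_{i+k} = 0$ for $k < d - m$ have a free
  constant coefficient, which can be chosen so that $g$ has simple roots; $s$ is then a
  combination of the geometric sequences of these roots. If $m = d$, then $f$ is a multiple
  of $L^d$.
\<close>

subsection \<open>Moment sequences\<close>

text \<open>Induction on the nodes. Passing from \<open>s i\<close> to
  \<open>s (Suc i) - a * s i\<close> kills the geometric sequence of \<open>a\<close> and multiplies
  the weight of every other node \<open>t\<close> by \<open>t - a\<close>. So the differenced
  sequence is solved on the smaller set, its weights are divided by \<open>t - a\<close>, and the
  weight of \<open>a\<close> is chosen to match \<open>s 0\<close>.\<close>

lemma vandermonde_solvable:
  fixes s :: "nat \<Rightarrow> 'a::field"
  assumes "finite T"
  shows "\<exists>w. \<forall>i<card T. (\<Sum>t\<in>T. w t * t ^ i) = s i"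
  using assms
proof (induction T arbitrary: s rule: finite_induct)
  case (insert a T)
  obtain w where w: "\<And>i. i < card T \<Longrightarrow> (\<Sum>t\<in>T. w t * t ^ i) = s (Suc i) - a * s i"
    using insert.IH[of "\<lambda>i. s (Suc i) - a * s i"] by auto
  define w' where "w' t = w t / (t - a)" for t
  define v where "v = w'(a := s 0 - (\<Sum>t\<in>T. w' t))"
  have T: "(\<Sum>t\<in>T. v t * t ^ i) = (\<Sum>t\<in>T. w' t * t ^ i)" for i
    using insert.hyps by (intro sum.cong) (auto simp: v_def)
  have "(\<Sum>t\<in>insert a T. v t * t ^ i) = s i" if "i < Suc (card T)" for i
    using that
  proof (induction i)
    case 0
    then show ?case using insert.hyps T[of 0] by (simp add: v_def)
  next
    case (Suc i)
    have "w' t * (t - a) = w t" if "t \<in> T" for t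
      using that insert.hyps by (auto simp: w'_def)
    then have "(\<Sum>t\<in>T. w' t * (t - a) * t ^ i) = s (Suc i) - a * s i"
      using w[of i] Suc.prems by simp
    then have "(\<Sum>t\<in>T. w' t * t ^ Suc i) = a * (\<Sum>t\<in>T. w' t * t ^ i) + (s (Suc i) - a * s i)"
      by (simp add: algebra_simps sum_subtractf sum_distrib_left)
    moreover have "s i = v a * a ^ i + (\<Sum>t\<in>T. w' t * t ^ i)"
      using Suc insert.hyps by (simp add: T)
    ultimately have "v a * a ^ Suc i + (\<Sum>t\<in>T. w' t * t ^ Suc i) = s (Suc i)"
      by (simp add: algebra_simps)
    then show ?case
      using insert.hyps T[of "Suc i"] by simp
  qed
  then show ?case using insert.hyps by auto
qed simp

text \<open>The geometric sequence of each root of the characteristic polynomial \<open>g\<close>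
  obeys the recurrence, hence so does every combination \<open>q\<close> of them. Vandermonde
  weights make \<open>q\<close> agree with \<open>s\<close> on the first \<open>card T\<close>
  terms, and the nonzero leading coefficient propagates the agreement up to
  \<open>d\<close>.\<close>

lemma recurrence_extends_moments:
  fixes s :: "nat \<Rightarrow> 'a::field"
  assumes T: "finite T" "\<And>t. t \<in> T \<Longrightarrow> (\<Sum>i\<le>card T. g i * t ^ i) = 0"
    and g: "g (card T) \<noteq> 0"
    and rec: "\<And>k. k + card T \<le> d \<Longrightarrow> (\<Sum>i\<le>card T. g i * s (i + k)) = 0"
  shows "\<exists>w. \<forall>i\<le>d. s i = (\<Sum>t\<in>T. w t * t ^ i)"
proof -
  define n where "n = card T"
  obtain w where w: "\<And>i. i < n \<Longrightarrow> (\<Sum>t\<in>T. w t * t ^ i) = s i"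
    using vandermonde_solvable[OF T(1)] unfolding n_def by blast
  define q where "q i = (\<Sum>t\<in>T. w t * t ^ i)" for i
  have recq: "(\<Sum>i\<le>n. g i * q (i + k)) = 0" for k
  proof -
    have "(\<Sum>i\<le>n. g i * q (i + k)) = (\<Sum>t\<in>T. \<Sum>i\<le>n. g i * (w t * t ^ (i + k)))"
      unfolding q_def sum_distrib_left by (rule sum.swap)
    also have "\<dots> = (\<Sum>t\<in>T. w t * t ^ k * (\<Sum>i\<le>n. g i * t ^ i))"
      by (simp add: sum_distrib_left power_add mult_ac)
    finally show ?thesis using T(2) by (simp add: n_def)
  qed
  have "s i = q i" if "i \<le> d" for i
    using that
  proof (induction i rule: less_induct)
    case (less i)
    show ?case
    proof (cases "i < n")
      case True
      then show ?thesis using w by (simp add: q_def)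
    next
      case False
      define k where "k = i - n"
      have i: "i = n + k" using False by (simp add: k_def)
      have "(\<Sum>j<n. g j * s (j + k)) = (\<Sum>j<n. g j * q (j + k))"
        using less by (intro sum.cong) (auto simp: i)
      moreover have "(\<Sum>j\<le>n. g j * s (j + k)) = (\<Sum>j\<le>n. g j * q (j + k))"
        using rec[of k] recq[of k] less.prems by (simp add: n_def i)
      ultimately have "g n * s (n + k) = g n * q (n + k)"
        by (simp flip: lessThan_Suc_atMost)
      then show ?thesis using g by (simp add: i n_def)
    qed
  qed
  then show ?thesis unfolding q_def by blast
qed

text \<open>A multiple root \<open>z\<close> of the shifted polynomial is a zero of
  \<open>pderiv h\<close> with \<open>c = - poly h z\<close>. There are finitely many such
  \<open>z\<close>, so only finitely many \<open>c\<close> are bad.\<close>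

lemma exists_shift_rsquarefree:
  fixes h :: "complex poly"
  assumes "degree h > 0"
  shows "\<exists>c. rsquarefree (h + [:c:])"
proof -
  have "pderiv h \<noteq> 0" using assms by (simp add: pderiv_eq_0_iff)
  then have "finite ((\<lambda>z. - poly h z) ` {z. poly (pderiv h) z = 0})"
    by (intro finite_imageI poly_roots_finite)
  then obtain c where "c \<notin> (\<lambda>z. - poly h z) ` {z. poly (pderiv h) z = 0}"
    using ex_new_if_finite[OF infinite_UNIV_char_0] by blast
  then have "rsquarefree (h + [:c:])"
    unfolding rsquarefree_roots by (auto simp: pderiv_add pderiv_pCons image_iff add_eq_0_iff)
  then show ?thesis ..
qed

lemma card_roots_rsquarefree:
  fixes p :: "complex poly"
  assumes "rsquarefree p"
  shows "card {z. poly p z = 0} = degree p"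
proof -
  have "p \<noteq> 0" using assms by (simp add: rsquarefree_def)
  have "degree p = degree (\<Prod>z | poly p z = 0. [:- z, 1:])"
    using complex_poly_decompose_rsquarefree[OF assms] \<open>p \<noteq> 0\<close>
    by (metis degree_smult_eq leading_coeff_0_iff)
  also have "\<dots> = (\<Sum>z | poly p z = 0. degree [:- z, 1:])"
    by (rule degree_prod_eq_sum_degree) auto
  finally show ?thesis by simp
qed

section \<open>Lower and upper bounds for the number of terms in a moment representation\<close>

lemma moments_lower_bound:
  fixes s :: "nat \<Rightarrow> 'a::field"
  assumes s: "\<And>i. i \<le> d \<Longrightarrow> s i = (\<Sum>j<r. u j ^ i * v j ^ (d - i))"
    and zero: "\<And>i. i < m \<Longrightarrow> s i = 0" and "s m \<noteq> 0" "m < d"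
  shows "m < r"
proof (rule ccontr)
  assume "\<not> m < r"
  \<comment> \<open>The power of the variable pads the product over the \<open>r\<close> ratios to
    degree exactly \<open>m\<close>, so that the leading coefficient 1 is paired with
    \<open>s m\<close>.\<close>
  define G where "G = monom 1 (m - r) * (\<Prod>j<r. [:- (u j / v j), 1:])"
  have deg: "degree G = m" 
    unfolding G_def using \<open>\<not> m < r\<close>
    by (subst degree_mult_eq) (auto simp: degree_monom_eq degree_prod_eq_sum_degree)
  have lc: "coeff G m = 1"
    using deg lead_coeff_mult[of "monom 1 (m - r)" "\<Prod>j<r. [:- (u j / v j), 1:]"]
    by (simp add: G_def lead_coeff_prod degree_monom_eq)
  have vanish: "(\<Sum>i\<le>m. coeff G i * (u j ^ i * v j ^ (d - i))) = 0" if "j < r" for j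
  proof (cases "v j = 0")
    \<comment> \<open>Here the root \<open>u j / v j = 0\<close> of \<open>G\<close> is junk, but \<open>m < d\<close> keeps a factor \<open>v j\<close> in every term.\<close>
    case True
    then show ?thesis using \<open>m < d\<close> by (auto intro!: sum.neutral)
  next
    case False
    have "(\<Sum>i\<le>m. coeff G i * (u j ^ i * v j ^ (d - i))) = v j ^ d * poly G (u j / v j)"
      unfolding poly_altdef deg sum_distrib_left using False \<open>m < d\<close>
      by (intro sum.cong) (auto simp: power_diff power_divide)
    also have "poly G (u j / v j) = 0"
      using that by (auto simp: G_def poly_prod)
    finally show ?thesis by simp
  qed
  have "(\<Sum>i\<le>m. coeff G i * s i) = (\<Sum>i\<le>m. \<Sum>j<r. coeff G i * (u j ^ i * v j ^ (d - i)))"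
    using s \<open>m < d\<close> by (intro sum.cong) (auto simp: sum_distrib_left)
  also have "\<dots> = 0"
    by (subst sum.swap) (simp add: vanish)
  finally have "(\<Sum>i\<le>m. coeff G i * s i) = 0" .
  \<comment> \<open>On \<open>s\<close> only the leading coefficient of \<open>G\<close> is felt,
    because the lower moments vanish.\<close>
  moreover have "(\<Sum>i\<le>m. coeff G i * s i) = s m"
    using zero by (simp add: lc flip: lessThan_Suc_atMost)
  ultimately show False using \<open>s m \<noteq> 0\<close> by simp
qed

text \<open>The bound \<open>d \<le> 2 * m\<close> leaves the constant coefficient of
  \<open>g\<close> free: a recurrence at shift \<open>k\<close> with
  \<open>k + Suc m \<le> d\<close> has \<open>k < m\<close>, so this coefficient multiplies
  \<open>s k = 0\<close>. It can therefore be used to make all roots of \<open>g\<close>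
  simple.\<close>

lemma moments_upper_bound:
  fixes s :: "nat \<Rightarrow> complex"
  assumes zero: "\<And>i. i < m \<Longrightarrow> s i = 0" and "s m \<noteq> 0" "m < d" "d \<le> 2 * m"
  shows "\<exists>u v. \<forall>i\<le>d. s i = (\<Sum>j<Suc m. u j ^ i * v j ^ (d - i))"
proof -
  \<comment> \<open>The triangular system for the nonconstant coefficients of \<open>g\<close> is solved by a power series inverse.\<close>
  define S where "S = Abs_fps (\<lambda>e. s (m + e))"
  define \<alpha> where "\<alpha> = fps_nth (inverse S)"
  have conv: "(\<Sum>n\<le>Suc k. \<alpha> n * s (m + (Suc k - n))) = 0" for k
  proof -
    have "inverse S * S = 1"
      using \<open>s m \<noteq> 0\<close> by (intro inverse_mult_eq_1) (simp add: S_def)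
    then have "fps_nth (inverse S * S) (Suc k) = 0" by simp
    then show ?thesis by (simp add: fps_mult_nth \<alpha>_def S_def atMost_atLeast0)
  qed
  have \<alpha>0: "\<alpha> 0 \<noteq> 0" using \<open>s m \<noteq> 0\<close> by (simp add: \<alpha>_def S_def)
  \<comment> \<open>The coefficients of the inverse series enter in reversed order, so that the
    recurrence at shift \<open>k\<close> becomes the coefficient of index \<open>Suc k\<close> in
    the product of \<open>S\<close> and its inverse, which is 0.\<close>
  define h where "h = (\<Sum>i\<le>m. monom (\<alpha> (m - i)) (Suc i))"
  have coeff_h: "coeff h k = (if 0 < k \<and> k \<le> Suc m then \<alpha> (Suc m - k) else 0)" for k
    by (cases k) (auto simp: h_def coeff_sum)
  obtain c where c: "rsquarefree (h + [:c:])"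
  proof -
    have "Suc m \<le> degree h" using \<alpha>0 by (intro le_degree) (simp add: coeff_h)
    then show ?thesis using exists_shift_rsquarefree[of h] that by auto
  qed
  define g where "g = h + [:c:]"
  have coeff_g: "coeff g 0 = c" "coeff g (Suc i) = (if i \<le> m then \<alpha> (m - i) else 0)" for i
    by (auto simp: g_def coeff_h)
  have deg_g: "degree g = Suc m"
  proof (rule antisym)
    show "degree g \<le> Suc m"
      by (rule degree_le) (auto simp: coeff_g Suc_less_eq2)
    show "Suc m \<le> degree g"
      by (rule le_degree) (simp add: coeff_g \<alpha>0)
  qed
  define T where "T = {z. poly g z = 0}"
  have cT: "card T = Suc m"
    using card_roots_rsquarefree[OF c] deg_g by (simp add: T_def g_def)
  then have "finite T" using card.infinite by fastforce
  have "(\<Sum>i\<le>card T. coeff g i * s (i + k)) = 0" if "k + card T \<le> d" for k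
  proof -
    have k: "Suc k \<le> d - m" "k < m" using that \<open>d \<le> 2 * m\<close> by (auto simp: cT)
    have "(\<Sum>i\<le>card T. coeff g i * s (i + k)) = c * s k + (\<Sum>i\<le>m. \<alpha> (m - i) * s (Suc i + k))"
      unfolding cT sum.atMost_Suc_shift by (simp add: coeff_g)
    also have "(\<Sum>i\<le>m. \<alpha> (m - i) * s (Suc i + k)) = (\<Sum>n\<le>m. \<alpha> n * s (Suc (m - n) + k))"
      by (rule sum.reindex_bij_witness[of _ "\<lambda>n. m - n" "\<lambda>n. m - n"]) auto
    \<comment> \<open>Terms with \<open>n > Suc k\<close> contain \<open>s\<close> at an index below
      \<open>m\<close> and vanish.\<close>
    also have "\<dots> = (\<Sum>n\<le>Suc k. \<alpha> n * s (m + (Suc k - n)))"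
      using k zero by (intro sum.mono_neutral_cong_right) (auto simp: Suc_diff_le)
    finally show ?thesis using zero k conv[of k] by simp
  qed
  moreover have "(\<Sum>i\<le>card T. coeff g i * t ^ i) = 0" if "t \<in> T" for t
    using that unfolding cT by (simp add: T_def poly_altdef deg_g)
  ultimately obtain w where w: "\<And>i. i \<le> d \<Longrightarrow> s i = (\<Sum>t\<in>T. w t * t ^ i)"
    using recurrence_extends_moments[of T "coeff g" d s] \<open>finite T\<close> \<alpha>0 by (auto simp: cT coeff_g)
  obtain t where t: "bij_betw t {..<Suc m} T"
    using ex_bij_betw_nat_finite[OF \<open>finite T\<close>] by (auto simp: cT atLeast0LessThan)
  \<comment> \<open>A \<open>d\<close>-th root of each weight lets the weight be absorbed into the
    linear form: the root \<open>z\<close> contributes the pair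
    \<open>(v z * z, v z)\<close>.\<close>
  have "\<forall>z. \<exists>y. y ^ d = w z" using nth_root_exists[of d] \<open>m < d\<close> by auto
  then obtain v where v: "\<And>z. v z ^ d = w z" by metis
  have "\<forall>i\<le>d. s i = (\<Sum>j<Suc m. (v (t j) * t j) ^ i * v (t j) ^ (d - i))"
  proof (intro allI impI)
    fix i assume i: "i \<le> d"
    have "w z * z ^ i = (v z * z) ^ i * v z ^ (d - i)" for z
      using i by (simp add: power_mult_distrib mult_ac flip: v power_add)
    then have "s i = (\<Sum>z\<in>T. (v z * z) ^ i * v z ^ (d - i))" using w[OF i] by simp
    then show "s i = (\<Sum>j<Suc m. (v (t j) * t j) ^ i * v (t j) ^ (d - i))"
      by (simp only: sum.reindex_bij_betw[OF t, of "\<lambda>z. (v z * z) ^ i * v z ^ (d - i)"])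
  qed
  then show ?thesis
    by (intro exI[of _ "\<lambda>j. v (t j) * t j"] exI[of _ "\<lambda>j. v (t j)"])
qed

subsection \<open>Forms in two linear coordinates\<close>

lemma const_0 [simp]: "const 0 = 0"
  and const_1 [simp]: "const 1 = 1"
  and const_add: "const (c + c') = const c + const c'"
  and const_diff: "const (c - c') = const c - const c'"
  and const_mult: "const (c * c') = const c * const c'"
  by (simp_all add: const_def one_pCons)

lemma const_power: "const (c ^ n) = const c ^ n"
  by (induction n) (simp_all add: const_mult)

lemma const_of_nat: "const (of_nat n) = of_nat n"
  by (simp add: const_def of_nat_poly)

lemma const_sum: "const (sum c A) = (\<Sum>i\<in>A. const (c i))"
  by (induction A rule: infinite_finite_induct) (simp_all add: const_add)

lemma eval2_0 [simp]: "eval2 0 x y = 0"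
  and eval2_1 [simp]: "eval2 1 x y = 1"
  and eval2_add [simp]: "eval2 (f + g) x y = eval2 f x y + eval2 g x y"
  and eval2_diff [simp]: "eval2 (f - g) x y = eval2 f x y - eval2 g x y"
  and eval2_mult [simp]: "eval2 (f * g) x y = eval2 f x y * eval2 g x y"
  and eval2_const [simp]: "eval2 (const c) x y = c"
  and eval2_X [simp]: "eval2 X x y = x"
  and eval2_Y [simp]: "eval2 Y x y = y"
  by (simp_all add: eval2_def const_def X_def Y_def)

lemma eval2_power [simp]: "eval2 (f ^ n) x y = eval2 f x y ^ n"
  by (induction n) simp_all

lemma eval2_sum [simp]: "eval2 (sum f A) x y = (\<Sum>i\<in>A. eval2 (f i) x y)"
  by (induction A rule: infinite_finite_induct) simp_all

text \<open>Binomial coefficients are kept out of \<open>c\<close>, which keeps multiplication by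
  \<open>L\<close> and \<open>M\<close> a mere shift of coefficients; they are divided out only when
  moments are formed. Both the pair \<open>X\<close>, \<open>Y\<close> and the adapted coordinates
  are used as \<open>L\<close>, \<open>M\<close>.\<close>

definition form_in ::
    "nat \<Rightarrow> (nat \<Rightarrow> complex) \<Rightarrow> complex poly poly \<Rightarrow> complex poly poly \<Rightarrow> complex poly poly" where
  "form_in d c L M = (\<Sum>i\<le>d. const (c i) * L ^ i * M ^ (d - i))"

lemma form_in_cong: "(\<And>i. i \<le> d \<Longrightarrow> c i = c' i) \<Longrightarrow> form_in d c L M = form_in d c' L M"
  by (simp add: form_in_def)

lemma form_in_add: "form_in d c L M + form_in d c' L M = form_in d (\<lambda>i. c i + c' i) L M"
  by (simp add: form_in_def const_add distrib_right sum.distrib)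

lemma form_in_scale: "const k * form_in d c L M = form_in d (\<lambda>i. k * c i) L M"
  by (simp add: form_in_def const_mult sum_distrib_left mult.assoc)

lemma form_in_sum: "(\<Sum>j\<in>J. form_in d (c j) L M) = form_in d (\<lambda>i. \<Sum>j\<in>J. c j i) L M"
  unfolding form_in_def const_sum sum_distrib_right by (rule sum.swap)

lemma form_in_mult_left:
  "L * form_in d c L M = form_in (Suc d) (\<lambda>i. case i of 0 \<Rightarrow> 0 | Suc j \<Rightarrow> c j) L M"
  unfolding form_in_def sum.atMost_Suc_shift by (simp add: sum_distrib_left mult_ac)

lemma form_in_mult_right:
  "M * form_in d c L M = form_in (Suc d) (\<lambda>i. if i \<le> d then c i else 0) L M"
  by (simp add: form_in_def sum_distrib_left mult_ac Suc_diff_le)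

lemma linear_form_power:
  "(const u * L + const v * M) ^ d =
    form_in d (\<lambda>i. of_nat (d choose i) * (u ^ i * v ^ (d - i))) L M"
  by (simp add: form_in_def binomial_ring const_mult const_power const_of_nat
      power_mult_distrib mult_ac)

lemma eval2_form_in:
  "eval2 (form_in d c L M) x y = (\<Sum>i\<le>d. c i * eval2 L x y ^ i * eval2 M x y ^ (d - i))"
  by (simp add: form_in_def)

lemma binary_form_eq_form_in:
  assumes "binary_form d f"
  shows "f = form_in d (\<lambda>i. coeff (coeff f (d - i)) i) X Y"
proof (intro poly_eqI)
  fix i j
  have monomial: "const c * X ^ k * Y ^ l = monom (monom c k) l" for c k l
    by (simp add: const_def X_def Y_def poly_const_pow monom_altdef)
  have "coeff (coeff (form_in d (\<lambda>i. coeff (coeff f (d - i)) i) X Y) j) i =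
      (\<Sum>k\<le>d. if d - k = j \<and> k = i then coeff (coeff f (d - k)) k else 0)"
    by (auto simp: form_in_def monomial coeff_sum intro!: sum.cong)
  also have "\<dots> = (\<Sum>k\<le>d. if k = i then if d - k = j then coeff (coeff f (d - k)) k else 0 else 0)"
    by (intro sum.cong) auto
  also have "\<dots> = coeff (coeff f j) i"
  proof (cases "coeff (coeff f j) i = 0")
    case False
    then have "i + j = d" using assms by (simp add: binary_form_def)
    then show ?thesis by auto
  qed auto
  finally show "coeff (coeff f j) i =
      coeff (coeff (form_in d (\<lambda>i. coeff (coeff f (d - i)) i) X Y) j) i" ..
qed

text \<open>If the coefficient of \<open>X ^ d\<close> vanishes, the point at infinity is a root;
  otherwise setting \<open>Y\<close> to 1 leaves a polynomial of positive degree over an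
  algebraically closed field. This ensures that the highest multiplicity is a maximum over a
  nonempty set.\<close>

lemma binary_form_has_root:
  assumes "binary_form d f" "d > 0"
  shows "\<exists>a b. (a, b) \<noteq> (0, 0) \<and> eval2 f a b = 0"
proof -
  obtain c where f: "f = form_in d c X Y"
    using binary_form_eq_form_in[OF assms(1)] by blast
  show ?thesis
  proof (cases "c d = 0")
    case True
    then have "eval2 f 1 0 = 0"
      by (auto simp: f eval2_form_in power_0_left intro!: sum.neutral)
    then show ?thesis by (intro exI[of _ 1] exI[of _ 0]) simp
  next
    case False
    then obtain x where "(\<Sum>k\<le>d. c k * x ^ k) = 0"
      using alg_closed[of d c] assms(2) by blast
    then have "eval2 f x 1 = 0" by (simp add: f eval2_form_in)
    then show ?thesis by (intro exI[of _ x] exI[of _ 1]) simp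
  qed
qed

text \<open>The equation says that the change from \<open>X\<close>, \<open>Y\<close> to
  \<open>L\<close>, \<open>M\<close> has determinant 1, so its inverse needs no division. It also
  says that \<open>M\<close> takes the value 1 at the point \<open>(a, b)\<close>, where
  \<open>L\<close> vanishes.\<close>

locale unimodular_coordinates =
  fixes a b p q :: complex
  assumes det: "b * q + a * p = 1"
begin

definition L :: "complex poly poly" where "L = const b * X - const a * Y"
definition M :: "complex poly poly" where "M = const p * X + const q * Y"

lemma X_eq: "X = const q * L + const a * M"
proof -
  have "const q * L + const a * M = const (b * q + a * p) * X"
    unfolding L_def M_def const_add const_mult by (simp add: algebra_simps)
  then show ?thesis by (simp add: det)
qed

lemma Y_eq: "Y = const (- p) * L + const b * M"
proof -
  have "const (- p) * L + const b * M = const (b * q + a * p) * Y"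
    using const_diff[of 0 p] unfolding L_def M_def const_add const_mult by (simp add: algebra_simps)
  then show ?thesis by (simp add: det)
qed

text \<open>The points \<open>(q * z + a, b - p * z)\<close> parametrize the line on which
  \<open>M\<close> equals 1, with \<open>L\<close> as the parameter; evaluating there dehomogenizes
  a form.\<close>

lemma eval2_L: "eval2 L (q * z + a) (b - p * z) = z"
proof -
  have "eval2 L (q * z + a) (b - p * z) = (b * q + a * p) * z"
    by (simp add: L_def algebra_simps)
  then show ?thesis by (simp add: det)
qed

lemma eval2_M: "eval2 M (q * z + a) (b - p * z) = 1"
proof -
  have "eval2 M (q * z + a) (b - p * z) = b * q + a * p"
    by (simp add: M_def algebra_simps)
  then show ?thesis by (simp add: det)
qed

text \<open>On the line where \<open>M\<close> equals 1 both sides become polynomial functions of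
  \<open>z\<close>, whose coefficients are determined by their values.\<close>

lemma form_in_inject:
  assumes "form_in d c L M = form_in d c' L M" "i \<le> d"
  shows "c i = c' i"
proof -
  have "(\<Sum>i\<le>d. c i * z ^ i) = (\<Sum>i\<le>d. c' i * z ^ i)" for z
    using arg_cong[OF assms(1), of "\<lambda>f. eval2 f (q * z + a) (b - p * z)"]
    by (simp add: eval2_form_in eval2_L eval2_M)
  then show ?thesis using assms(2) polyfun_eq_coeffs[of c d c'] by blast
qed

lemma linear_mult_form_in:
  "\<exists>c'. (const u * L + const v * M) * form_in d c L M = form_in (Suc d) c' L M"
proof -
  have "(const u * L + const v * M) * form_in d c L M =
      const u * (L * form_in d c L M) + const v * (M * form_in d c L M)"
    by (simp add: algebra_simps)
  then show ?thesis
    unfolding form_in_mult_left form_in_mult_right form_in_scale form_in_add by blast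
qed

section \<open>Expansion of arbitrary binary forms in the adapted coordinates\<close>

lemma monomial_eq_form_in: "\<exists>c. X ^ i * Y ^ j = form_in (i + j) c L M"
proof (induction i)
  case 0
  show ?case
  proof (induction j)
    case 0
    have "X ^ 0 * Y ^ 0 = form_in 0 (\<lambda>_. 1) L M" by (simp add: form_in_def)
    then show ?case by auto
  next
    case (Suc j)
    then obtain c where "Y ^ j = form_in j c L M" by auto
    then have "X ^ 0 * Y ^ Suc j = (const (- p) * L + const b * M) * form_in j c L M"
      by (simp add: Y_eq[symmetric])
    then show ?case using linear_mult_form_in by simp
  qed
next
  case (Suc i)
  then obtain c where "X ^ i * Y ^ j = form_in (i + j) c L M" by auto
  then have "X ^ Suc i * Y ^ j = (const q * L + const a * M) * form_in (i + j) c L M"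
    by (simp add: X_eq[symmetric] mult.assoc)
  then show ?case using linear_mult_form_in by simp
qed

lemma binary_form_in_coordinates:
  assumes "binary_form d f"
  shows "\<exists>c. f = form_in d c L M"
proof -
  have "\<forall>i. \<exists>e. i \<le> d \<longrightarrow> X ^ i * Y ^ (d - i) = form_in d e L M"
    using monomial_eq_form_in by (metis le_add_diff_inverse)
  then obtain e where e: "\<And>i. i \<le> d \<Longrightarrow> X ^ i * Y ^ (d - i) = form_in d (e i) L M"
    by metis
  obtain c where "f = form_in d c X Y" using binary_form_eq_form_in[OF assms] by blast
  then have "f = (\<Sum>i\<le>d. const (c i) * form_in d (e i) L M)"
    by (simp add: form_in_def[of d c X Y] e mult.assoc)
  then show ?thesis unfolding form_in_scale form_in_sum by blast
qed

lemma binary_form_1_in_coordinates: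
  "binary_form 1 l \<longleftrightarrow> (\<exists>u v. l = const u * L + const v * M)"
proof
  assume "binary_form 1 l"
  then obtain c where "l = form_in 1 c L M" using binary_form_in_coordinates by blast
  then have "l = const (c 1) * L + const (c 0) * M" by (simp add: form_in_def)
  then show "\<exists>u v. l = const u * L + const v * M" by blast
next
  assume "\<exists>u v. l = const u * L + const v * M"
  then obtain u v where "l = const u * L + const v * M" by blast
  then have "l = const (u * b + v * p) * X + const (v * q - u * a) * Y"
    unfolding L_def M_def const_add const_diff const_mult by (simp add: algebra_simps)
  then show "binary_form 1 l" unfolding binary_form_1_iff by blast
qed

text \<open>The bridge from Waring decompositions to moments: expand each power by the binomial
  theorem, compare coefficients, and divide by the binomial coefficients. Being an equivalence for
  every \<open>r\<close>, it can be rewritten under the minimum defining the rank.\<close>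

lemma sum_powers_iff_moments:
  "(\<exists>l. (\<forall>j<r. binary_form 1 (l j)) \<and> form_in d c L M = (\<Sum>j<r. l j ^ d)) \<longleftrightarrow>
    (\<exists>u v. \<forall>i\<le>d. c i / of_nat (d choose i) = (\<Sum>j<r. u j ^ i * v j ^ (d - i)))"
    (is "?powers \<longleftrightarrow> ?moments")
proof -
  have sum: "(\<Sum>j<r. (const (u j) * L + const (v j) * M) ^ d) =
      form_in d (\<lambda>i. of_nat (d choose i) * (\<Sum>j<r. u j ^ i * v j ^ (d - i))) L M" for u v
    unfolding linear_form_power form_in_sum sum_distrib_left ..
  show ?thesis
  proof
    assume ?powers
    then obtain l where l: "\<And>j. j < r \<Longrightarrow> binary_form 1 (l j)"
      "form_in d c L M = (\<Sum>j<r. l j ^ d)" by blast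
    obtain u v where "\<And>j. j < r \<Longrightarrow> l j = const (u j) * L + const (v j) * M"
      using l(1) unfolding binary_form_1_in_coordinates by metis
    then have "form_in d c L M =
        form_in d (\<lambda>i. of_nat (d choose i) * (\<Sum>j<r. u j ^ i * v j ^ (d - i))) L M"
      by (simp add: l(2) flip: sum)
    from form_in_inject[OF this] show ?moments
      by (intro exI[of _ u] exI[of _ v]) auto
  next
    assume ?moments
    then obtain u v where uv: "\<And>i. i \<le> d \<Longrightarrow>
      c i / of_nat (d choose i) = (\<Sum>j<r. u j ^ i * v j ^ (d - i))" by blast
    have "form_in d c L M = (\<Sum>j<r. (const (u j) * L + const (v j) * M) ^ d)"
      unfolding sum by (intro form_in_cong) (simp flip: uv)
    then show ?powers
      unfolding binary_form_1_in_coordinates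
      by (intro exI[of _ "\<lambda>j. const (u j) * L + const (v j) * M"]) blast
  qed
qed

text \<open>After \<open>L ^ m\<close> is split off, the cofactor takes the value \<open>c m\<close>
  at \<open>(a, b)\<close>, because \<open>L\<close> is 0 and \<open>M\<close> is 1 there; hence
  \<open>L\<close> does not divide it.\<close>

lemma root_multiplicity_form_in:
  assumes "m \<le> d" "\<And>i. i < m \<Longrightarrow> c i = 0" "c m \<noteq> 0"
  shows "root_multiplicity (form_in d c L M) a b = m"
proof -
  define g where "g = form_in (d - m) (\<lambda>i. c (m + i)) L M"
  have "form_in d c L M = (\<Sum>i\<in>{m..d}. const (c i) * L ^ i * M ^ (d - i))"
    unfolding form_in_def using assms(2) by (intro sum.mono_neutral_right) auto
  also have "\<dots> = (\<Sum>i\<le>d - m. const (c (m + i)) * L ^ (m + i) * M ^ (d - (m + i)))"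
    using assms(1)
    by (intro sum.reindex_bij_witness[of _ "\<lambda>i. m + i" "\<lambda>i. i - m"]) auto
  also have "\<dots> = L ^ m * g"
    by (simp add: g_def form_in_def sum_distrib_left power_add mult_ac)
  finally have f: "form_in d c L M = L ^ m * g" .
  have "eval2 L a b = 0" "eval2 M a b = 1" using eval2_L[of 0] eval2_M[of 0] by simp_all
  then have "eval2 g a b = (\<Sum>i\<le>d - m. if i = 0 then c m else 0)"
    unfolding g_def eval2_form_in by (intro sum.cong) auto
  then have g: "eval2 g a b \<noteq> 0" using assms(3) by simp
  have "L \<noteq> 0" using eval2_L[of 1] by auto
  have "\<not> L dvd g" using g \<open>eval2 L a b = 0\<close> by (auto elim!: dvdE)
  then have "multiplicity L (L ^ m * g) = m"
    using \<open>L \<noteq> 0\<close> by (intro multiplicity_eqI) (auto simp: power_Suc2 simp del: power_Suc)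
  then show ?thesis by (simp add: root_multiplicity_def f flip: L_def)
qed

text \<open>The multiplicity is the index of the first nonzero coefficient. The point need not be a
  root: then \<open>m\<close> is 0.\<close>

lemma binary_form_at_root:
  assumes "f \<noteq> 0" "binary_form d f"
  defines "m \<equiv> root_multiplicity f a b"
  obtains c where "f = form_in d c L M" "m \<le> d" "\<And>i. i < m \<Longrightarrow> c i = 0" "c m \<noteq> 0"
proof -
  obtain c where f: "f = form_in d c L M" using binary_form_in_coordinates assms(2) by blast
  have "\<exists>i\<le>d. c i \<noteq> 0" using assms(1) unfolding f form_in_def by (metis (no_types, lifting) atMost_iff const_0 mult_zero_left sum.neutral)
  then obtain k where k: "k \<le> d" "c k \<noteq> 0" "\<And>i. i < k \<Longrightarrow> c i = 0"
    using exists_least_iff[of "\<lambda>i. i \<le> d \<and> c i \<noteq> 0"] by (metis le_trans less_imp_le)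
  have "m = k" unfolding m_def f using k by (intro root_multiplicity_form_in)
  then show ?thesis using that f k by blast
qed

end

subsection \<open>Rank and multiplicity\<close>

lemma exists_unimodular_coordinates:
  assumes "(a, b) \<noteq> (0, 0)"
  shows "\<exists>p q. unimodular_coordinates a b p q"
proof (cases "a = 0")
  case True
  then have "unimodular_coordinates a b 0 (1 / b)" using assms by unfold_locales simp
  then show ?thesis by blast
next
  case False
  then have "unimodular_coordinates a b (1 / a) 0" by unfold_locales simp
  then show ?thesis by blast
qed

lemma root_multiplicity_le_degree:
  assumes "f \<noteq> 0" "binary_form d f" "(a, b) \<noteq> (0, 0)"
  shows "root_multiplicity f a b \<le> d"
proof -
  obtain p q where "unimodular_coordinates a b p q"
    using exists_unimodular_coordinates assms(3) by blast
  then show ?thesis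
    using unimodular_coordinates.binary_form_at_root[OF _ assms(1,2)] by metis
qed

text \<open>Division by the nonzero binomial coefficients preserves the position of the first
  nonzero term, so the two moment bounds apply to \<open>s\<close> and meet at
  \<open>Suc m\<close>.\<close>

lemma waring_rank_eq_Suc_multiplicity:
  assumes "f \<noteq> 0" "binary_form d f" "(a, b) \<noteq> (0, 0)"
    and "root_multiplicity f a b = m" "m < d" "d \<le> 2 * m"
  shows "waring_rank d f = Suc m"
proof -
  obtain p q where "unimodular_coordinates a b p q"
    using exists_unimodular_coordinates assms(3) by blast
  then interpret unimodular_coordinates a b p q .
  obtain c where c: "f = form_in d c L M" "\<And>i. i < m \<Longrightarrow> c i = 0" "c m \<noteq> 0"
    using binary_form_at_root[OF assms(1,2)] assms(4) by metis
  define s where "s i = c i / of_nat (d choose i)" for i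
  have s: "\<And>i. i < m \<Longrightarrow> s i = 0" "s m \<noteq> 0" using c(2,3) assms(5) by (auto simp: s_def)
  show ?thesis
    unfolding waring_rank_def c(1) sum_powers_iff_moments s_def[symmetric]
  proof (rule Least_equality)
    show "\<exists>u v. \<forall>i\<le>d. s i = (\<Sum>j<Suc m. u j ^ i * v j ^ (d - i))"
      using s assms(5,6) by (intro moments_upper_bound)
  next
    fix r :: nat
    assume "\<exists>u v. \<forall>i\<le>d. s i = (\<Sum>j<r. u j ^ i * v j ^ (d - i))"
    then obtain u v where "\<And>i. i \<le> d \<Longrightarrow> s i = (\<Sum>j<r. u j ^ i * v j ^ (d - i))" by blast
    then show "Suc m \<le> r"
      using moments_lower_bound[where s = s and m = m and d = d] s assms(5) by (intro Suc_leI) blast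
  qed
qed

lemma waring_rank_eq_1:
  assumes "f \<noteq> 0" "binary_form d f" "(a, b) \<noteq> (0, 0)" "root_multiplicity f a b = d" "d > 0"
  shows "waring_rank d f = 1"
proof -
  obtain p q where "unimodular_coordinates a b p q"
    using exists_unimodular_coordinates assms(3) by blast
  then interpret unimodular_coordinates a b p q .
  obtain c where c: "f = form_in d c L M" "\<And>i. i < d \<Longrightarrow> c i = 0" "c d \<noteq> 0"
    using binary_form_at_root[OF assms(1,2)] assms(4) by metis
  obtain z where z: "z ^ d = c d" using nth_root_exists[OF assms(5)] by blast
  show ?thesis
    unfolding waring_rank_def
  proof (rule Least_equality)
    \<comment> \<open>The single summand is the \<open>d\<close>-th power of \<open>z\<close> times
      \<open>L\<close>; its \<open>M\<close> coefficient is 0, and \<open>0 ^ (d - i)\<close> is 1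
      exactly for \<open>i = d\<close>.\<close>
    have "c i / of_nat (d choose i) = (\<Sum>j<1::nat. z ^ i * 0 ^ (d - i))" if "i \<le> d" for i
      using that c(2)[of i] z by (cases "i = d") auto
    then have "\<exists>u v. \<forall>i\<le>d. c i / of_nat (d choose i) = (\<Sum>j<1::nat. u j ^ i * v j ^ (d - i))"
      by (intro exI[of _ "\<lambda>_. z"] exI[of _ "\<lambda>_. 0"]) simp
    then show "\<exists>l. (\<forall>j<1::nat. binary_form 1 (l j)) \<and> f = (\<Sum>j<1. l j ^ d)"
      by (simp only: c(1) sum_powers_iff_moments)
  next
    fix r :: nat
    assume "\<exists>l. (\<forall>j<r. binary_form 1 (l j)) \<and> f = (\<Sum>j<r. l j ^ d)"
    then show "1 \<le> r" using assms(1) by (cases r) auto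
  qed
qed

text \<open>The degree bounds the multiplicities and a root exists, so the maximum is over a finite
  nonempty set and belongs to it.\<close>

lemma highest_root_multiplicity_attained:
  assumes "f \<noteq> 0" "binary_form d f" "d > 0"
  shows "\<exists>a b. (a, b) \<noteq> (0, 0) \<and> root_multiplicity f a b = highest_root_multiplicity f"
proof -
  let ?A = "{root_multiplicity f a b | a b. (a, b) \<noteq> (0, 0) \<and> eval2 f a b = 0}"
  have "?A \<subseteq> {..d}" using root_multiplicity_le_degree[OF assms(1,2)] by auto
  then have "finite ?A" by (rule finite_subset) simp
  moreover have "?A \<noteq> {}" using binary_form_has_root[OF assms(2,3)] by blast
  ultimately have "Max ?A \<in> ?A" by (rule Max_in)
  then obtain a b where "(a, b) \<noteq> (0, 0)" "Max ?A = root_multiplicity f a b" by blast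
  then show ?thesis unfolding highest_root_multiplicity_def by metis
qed

theorem corollary1p1:
  fixes f :: "complex poly poly" and m :: nat
  assumes "f \<noteq> 0"
    and "binary_form 6 f"
    and "m = highest_root_multiplicity f"
    and "m \<ge> 3"
  shows "(m = 6 \<longleftrightarrow> waring_rank 6 f = 1) \<and>
         (m = 5 \<longleftrightarrow> waring_rank 6 f = 6) \<and>
         (m = 4 \<longrightarrow> waring_rank 6 f = 5) \<and>
         (m = 3 \<longrightarrow> waring_rank 6 f = 4)"
proof -
  obtain a b where ab: "(a, b) \<noteq> (0, 0)" "root_multiplicity f a b = m"
    using highest_root_multiplicity_attained[OF assms(1,2)] unfolding assms(3) by auto
  have "m \<le> 6" using root_multiplicity_le_degree[OF assms(1,2) ab(1)] ab(2) by simp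
  moreover have "waring_rank 6 f = Suc m" if "m < 6"
    using waring_rank_eq_Suc_multiplicity[OF assms(1,2) ab that] assms(4) by simp
  moreover have "waring_rank 6 f = 1" if "m = 6"
    using waring_rank_eq_1[OF assms(1,2) ab(1)] ab(2) that by simp
  \<comment> \<open>For \<open>m\<close> equal to 3, 4, 5, 6 the ranks are 4, 5, 6, 1. They are
    pairwise distinct, which gives the converse implications.\<close>
  ultimately show ?thesis using assms(4) by (cases "m = 6") auto
qed

end
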